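(* Let $q\ge 5$ be an odd prime power. Then the point graph of the incidence structure $(\mathcal{P}_1,\mathcal{C}_1)$ is a strongly regular graph with parameters $$v=(q-1)^2,\quad k=(q-2)(q-3),\quad \lambda=(q-4)^2+1,\quad \mu=(q-3)(q-4).$$
   Context: Points of the projective plane $\mathrm{PG}(2,q)$ over $\mathbb{F}_q$ are written in homogeneous coordinates, normalized so that the first nonzero coordinate is $1$. Let $e_1=(1,0,0)$, $e_2=(0,1,0)$, $e_3=(0,0,1)$. A conic (for $q$ odd) is the set of points $X=(x,y,z)$ of $\mathrm{PG}(2,q)$ with $XAX^T=0$, where $A$ is a symmetric $3\times3$ matrix over $\mathbb{F}_q$ with $\det A\ne0$ ($A$ and its nonzero scalar multiples represent the same conic). $\mathcal{P}_1$ is the set of points $P\notin\{e_1,e_2,e_3\}$ of $\mathrm{PG}(2,q)$ such that no three distinct points of $\{P,e_1,e_2,e_3\}$ are collinear; thus $\mathcal{P}_1=\{(1,x,y):x,y\in\mathbb{F}_q^*\}$. $\mathcal{C}_1$ is the set of all conics containing $e_1,e_2,e_3$; these are the conics with matrix $\begin{pmatrix} 0 & a & b \\ a & 0 & 1 \\ b & 1 & 0 \end{pmatrix}$, $a,b\in\mathbb{F}_q^*$. A point of $\mathcal{P}_1$ is incident with a conic of $\mathcal{C}_1$ if it lies on it. The point graph of an incidence structure $(\mathcal{P},\mathcal{B})$ has vertex set $\mathcal{P}$, two distinct points being adjacent if and only if some block of $\mathcal{B}$ is incident with both. A $k$-regular graph on $v$ vertices is strongly regular with parameters $(v,k,\lambda,\mu)$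 if any two adjacent vertices have exactly $\lambda$ common neighbours and any two distinct non-adjacent vertices have exactly $\mu$ common neighbours. *)

theory Defs
  imports "HOL-Analysis.Analysis" "HOL-Number_Theory.Prime_Powers"
begin

text \<open>
  The points of \<open>PG(2,q)\<close> are represented by their normalized homogeneous coordinate vectors.
  The coordinates are written out because the numeral \<open>3\<close> of the index type \<open>3\<close> equals \<open>0\<close>, so
  the order of that type does not list the coordinates as first, second, third.
\<close>

definition pg_points :: "('a::field ^ 3) set" where
  "pg_points = {X. X $ 1 = 1 \<or> (X $ 1 = 0 \<and> X $ 2 = 1) \<or> (X $ 1 = 0 \<and> X $ 2 = 0 \<and> X $ 3 = 1)}"

definition pg_lines :: "('a::field ^ 3) set set" where
  "pg_lines = {{X \<in> pg_points. (\<Sum>i\<in>UNIV. u $ i * X $ i) = 0} | u. u \<noteq> 0}"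

definition pg_collinear :: "('a::field ^ 3) set \<Rightarrow> bool" where
  "pg_collinear S \<longleftrightarrow> (\<exists>l\<in>pg_lines. S \<subseteq> l)"

definition e1 :: "'a::field ^ 3" where "e1 = vector [1, 0, 0]"
definition e2 :: "'a::field ^ 3" where "e2 = vector [0, 1, 0]"
definition e3 :: "'a::field ^ 3" where "e3 = vector [0, 0, 1]"

definition conic_of :: "'a::field ^ 3 ^ 3 \<Rightarrow> ('a ^ 3) set" where
  "conic_of A = {X \<in> pg_points. (\<Sum>i\<in>UNIV. X $ i * (A *v X) $ i) = 0}"

text \<open>This is the notion of a conic for fields of odd characteristic only.\<close>

definition conics :: "('a::field ^ 3) set set" where
  "conics = {conic_of A | A. transpose A = A \<and> det A \<noteq> 0}"

definition P1 :: "('a::field ^ 3) set" where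
  "P1 = {P \<in> pg_points - {e1, e2, e3}.
           \<forall>S \<subseteq> {P, e1, e2, e3}. card S = 3 \<longrightarrow> \<not> pg_collinear S}"

definition C1 :: "('a::field ^ 3) set set" where
  "C1 = {C \<in> conics. {e1, e2, e3} \<subseteq> C}"

text \<open>
  An incidence structure is given by its points, its blocks and its incidence relation; a graph
  is given by its vertex set and its adjacency relation.
\<close>

definition point_graph_adj ::
    "'p set \<Rightarrow> 'b set \<Rightarrow> ('p \<Rightarrow> 'b \<Rightarrow> bool) \<Rightarrow> 'p \<Rightarrow> 'p \<Rightarrow> bool" where
  "point_graph_adj \<P> \<B> I x y \<longleftrightarrow>
     x \<in> \<P> \<and> y \<in> \<P> \<and> x \<noteq> y \<and> (\<exists>b\<in>\<B>. I x b \<and> I y b)"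

definition simple_graph :: "'v set \<Rightarrow> ('v \<Rightarrow> 'v \<Rightarrow> bool) \<Rightarrow> bool" where
  "simple_graph V adj \<longleftrightarrow>
     finite V \<and> (\<forall>x y. adj x y \<longrightarrow> x \<in> V \<and> y \<in> V \<and> x \<noteq> y \<and> adj y x)"

definition regular_graph :: "'v set \<Rightarrow> ('v \<Rightarrow> 'v \<Rightarrow> bool) \<Rightarrow> nat \<Rightarrow> bool" where
  "regular_graph V adj k \<longleftrightarrow> (\<forall>x\<in>V. card {y \<in> V. adj x y} = k)"

definition common_neighbours :: "'v set \<Rightarrow> ('v \<Rightarrow> 'v \<Rightarrow> bool) \<Rightarrow> 'v \<Rightarrow> 'v \<Rightarrow> 'v set" where
  "common_neighbours V adj x y = {z \<in> V. adj x z \<and> adj y z}"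

definition strongly_regular ::
    "'v set \<Rightarrow> ('v \<Rightarrow> 'v \<Rightarrow> bool) \<Rightarrow> nat \<Rightarrow> nat \<Rightarrow> nat \<Rightarrow> nat \<Rightarrow> bool" where
  "strongly_regular V adj v k l m \<longleftrightarrow>
     simple_graph V adj \<and> card V = v \<and> regular_graph V adj k \<and>
     (\<forall>x\<in>V. \<forall>y\<in>V. adj x y \<longrightarrow> card (common_neighbours V adj x y) = l) \<and>
     (\<forall>x\<in>V. \<forall>y\<in>V. x \<noteq> y \<and> \<not> adj x y \<longrightarrow> card (common_neighbours V adj x y) = m)"

end

theory Submission imports Defs "HOL-Number_Theory.Residues" begin

text \<open>
  In the coordinates \<open>(1, x, y)\<close> with \<open>x, y \<noteq> 0\<close>, the conics through \<open>e1, e2, e3\<close> are the curves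
  \<open>a x + b y + c x y = 0\<close> with \<open>a, b, c \<noteq> 0\<close>. The inversion \<open>(x, y) \<mapsto> (1/x, 1/y)\<close> turns them into
  the lines that are neither horizontal, nor vertical, nor incident with the origin. Hence two points
  are adjacent iff they differ in \<open>x\<close>, in \<open>y\<close> and in \<open>y / x\<close>: the graph is the complement
  of the Latin square graph of the cyclic group \<open>F\<^sub>q\<^sup>*\<close>, and common neighbours are counted by fixing
  their first coordinate.
\<close>

subsection \<open>Points\<close>

definition affine_pt :: "'a::field \<times> 'a \<Rightarrow> 'a ^ 3" where
  "affine_pt p = vector [1, fst p, snd p]"

lemma affine_pt_nth [simp]:
  "affine_pt p $ 1 = 1" "affine_pt p $ 2 = fst p" "affine_pt p $ 3 = snd p"
  by (simp_all add: affine_pt_def)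

lemma basis_nth [simp]:
  "(e1 :: 'a::field ^ 3) $ 1 = 1" "(e1 :: 'a ^ 3) $ 2 = 0" "(e1 :: 'a ^ 3) $ 3 = 0"
  "(e2 :: 'a ^ 3) $ 1 = 0" "(e2 :: 'a ^ 3) $ 2 = 1" "(e2 :: 'a ^ 3) $ 3 = 0"
  "(e3 :: 'a ^ 3) $ 1 = 0" "(e3 :: 'a ^ 3) $ 2 = 0" "(e3 :: 'a ^ 3) $ 3 = 1"
  by (simp_all add: e1_def e2_def e3_def)

lemma vec3_eq_iff: "(X :: 'a ^ 3) = Y \<longleftrightarrow> X $ 1 = Y $ 1 \<and> X $ 2 = Y $ 2 \<and> X $ 3 = Y $ 3"
  by (simp add: vec_eq_iff forall_3)

lemma inj_affine_pt: "inj affine_pt"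
  by (auto simp: inj_on_def vec3_eq_iff prod_eq_iff)

lemma pg_points_basic [simp]:
  "e1 \<in> pg_points" "e2 \<in> pg_points" "e3 \<in> pg_points" "affine_pt p \<in> pg_points"
  by (simp_all add: pg_points_def)

lemma pg_collinear_iff:
  fixes S :: "('a::field ^ 3) set"
  shows "pg_collinear S \<longleftrightarrow>
     S \<subseteq> pg_points \<and> (\<exists>u :: 'a ^ 3. u \<noteq> 0 \<and> (\<forall>X\<in>S. u $ 1 * X $ 1 + u $ 2 * X $ 2 + u $ 3 * X $ 3 = 0))"
  unfolding pg_collinear_def pg_lines_def
  by (simp add: sum_3 subset_iff Bex_def ex_simps(1)[symmetric] del: ex_simps) blast

definition units2 :: "('a::field \<times> 'a) set" where
  "units2 = (UNIV - {0}) \<times> (UNIV - {0})"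

text \<open>A point with a zero coordinate lies on a side of the triangle \<open>e1\<close>,
  \<open>e2\<close>, \<open>e3\<close>. Conversely, a line contains at most two of
  \<open>e1\<close>, \<open>e2\<close>, \<open>e3\<close> and a point with no zero
  coordinate.\<close>

lemma P1_eq: "P1 = affine_pt ` (units2 :: ('a::field \<times> 'a) set)"
proof (intro equalityI subsetI)
  fix P :: "'a ^ 3" assume "P \<in> P1"
  then have P: "P \<in> pg_points" "P \<noteq> e1" "P \<noteq> e2" "P \<noteq> e3"
    and nc: "\<And>S. S \<subseteq> {P, e1, e2, e3} \<Longrightarrow> card S = 3 \<Longrightarrow> \<not> pg_collinear S"
    by (auto simp: P1_def)
  have d: "(e1 :: 'a ^ 3) \<noteq> e2" "(e1 :: 'a ^ 3) \<noteq> e3" "(e2 :: 'a ^ 3) \<noteq> e3"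
    by (simp_all add: vec3_eq_iff)
  have "\<not> pg_collinear {P, e2, e3}" "\<not> pg_collinear {P, e1, e3}" "\<not> pg_collinear {P, e1, e2}"
    using nc[of "{P, e2, e3}"] nc[of "{P, e1, e3}"] nc[of "{P, e1, e2}"] P d by simp_all
  \<comment> \<open>As a coefficient vector, \<open>e1\<close> gives the side on which the first
    coordinate vanishes; \<open>e2\<close> and \<open>e3\<close> serve likewise for the other two
    sides.\<close>
  moreover have "pg_collinear {P, e2, e3}" if "P $ 1 = 0"
    unfolding pg_collinear_iff using P(1) that
    by (intro conjI exI[of _ e1]) (simp_all add: vec3_eq_iff)
  moreover have "pg_collinear {P, e1, e3}" if "P $ 2 = 0"
    unfolding pg_collinear_iff using P(1) that
    by (intro conjI exI[of _ e2]) (simp_all add: vec3_eq_iff)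
  moreover have "pg_collinear {P, e1, e2}" if "P $ 3 = 0"
    unfolding pg_collinear_iff using P(1) that
    by (intro conjI exI[of _ e3]) (simp_all add: vec3_eq_iff)
  ultimately have nz: "P $ 1 \<noteq> 0" "P $ 2 \<noteq> 0" "P $ 3 \<noteq> 0"
    by blast+
  with P(1) have "P = affine_pt (P $ 2, P $ 3)"
    by (auto simp: vec3_eq_iff pg_points_def)
  with nz show "P \<in> affine_pt ` units2"
    by (auto simp: units2_def)
next
  fix P :: "'a ^ 3" assume "P \<in> affine_pt ` units2"
  then obtain x y where P: "P = affine_pt (x, y)" and xy: "x \<noteq> 0" "y \<noteq> 0"
    by (auto simp: units2_def)
  have "\<not> pg_collinear S" if S: "S \<subseteq> {P, e1, e2, e3}" "card S = 3" for S
  proof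
    assume "pg_collinear S"
    then obtain u :: "'a ^ 3" where u: "u \<noteq> 0"
      and on: "\<And>X. X \<in> S \<Longrightarrow> u $ 1 * X $ 1 + u $ 2 * X $ 2 + u $ 3 * X $ 3 = 0"
      by (auto simp: pg_collinear_iff)
    have e: "e1 \<in> S \<Longrightarrow> u $ 1 = 0" "e2 \<in> S \<Longrightarrow> u $ 2 = 0" "e3 \<in> S \<Longrightarrow> u $ 3 = 0"
      "P \<in> S \<Longrightarrow> u $ 1 + u $ 2 * x + u $ 3 * y = 0"
      using on[of e1] on[of e2] on[of e3] on[of P] by (simp_all add: P)
    have small: False if "S \<subseteq> {X, Y}" for X Y
      using card_mono[OF _ that] S(2) card_insert_le_m1[of 2 "{Y}" X] by auto
    \<comment> \<open>Cases by the support of \<open>u\<close>: two nonzero entries exclude two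
      basis points from \<open>S\<close>; a single nonzero entry excludes one basis point and also
      \<open>P\<close>, whose coordinates are all nonzero. Either way at most two points
      remain.\<close>
    have "u $ 1 \<noteq> 0 \<or> u $ 2 \<noteq> 0 \<or> u $ 3 \<noteq> 0"
      using u by (simp add: vec3_eq_iff)
    moreover have False if "u $ 1 \<noteq> 0" "u $ 2 \<noteq> 0"
      using small[of P e3] S(1) e that by blast
    moreover have False if "u $ 1 \<noteq> 0" "u $ 3 \<noteq> 0"
      using small[of P e2] S(1) e that by blast
    moreover have False if "u $ 2 \<noteq> 0" "u $ 3 \<noteq> 0"
      using small[of P e1] S(1) e that by blast
    moreover have False if "u $ 1 \<noteq> 0" "u $ 2 = 0" "u $ 3 = 0"
    proof -
      have "P \<notin> S" using e(4) that by auto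
      then show False using small[of e2 e3] S(1) e that by blast
    qed
    moreover have False if "u $ 1 = 0" "u $ 2 \<noteq> 0" "u $ 3 = 0"
    proof -
      have "P \<notin> S" using e(4) that xy by auto
      then show False using small[of e1 e3] S(1) e that by blast
    qed
    moreover have False if "u $ 1 = 0" "u $ 2 = 0" "u $ 3 \<noteq> 0"
    proof -
      have "P \<notin> S" using e(4) that xy by auto
      then show False using small[of e1 e2] S(1) e that by blast
    qed
    ultimately show False by blast
  qed
  moreover have "P \<in> pg_points" "P \<noteq> e1" "P \<noteq> e2" "P \<noteq> e3"
    using xy by (auto simp: P) (simp_all add: vec3_eq_iff)
  ultimately show "P \<in> P1" by (simp add: P1_def)
qed

subsection \<open>Adjacency\<close>

lemma two_neq_0_if_odd_CARD:
  assumes "odd CARD('a::{field,finite})"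
  shows "(2 :: 'a) \<noteq> 0"
proof
  assume "(2 :: 'a) = 0"
  then have "CHAR('a) dvd 2"
    using of_nat_eq_0_iff_char_dvd[of 2, where ?'a = 'a] by simp
  then have "CHAR('a) = 2"
    using CHAR_not_1'[where ?'a = 'a] two_is_prime_nat unfolding prime_nat_iff by auto
  with CHAR_dvd_CARD[where ?'a = 'a] assms show False by simp
qed

text \<open>The entry \<open>c\<close> is not scaled to 1, so every scalar multiple of a matrix is
  covered and no normalization is required.\<close>

definition conic_matrix :: "'a::field \<Rightarrow> 'a \<Rightarrow> 'a \<Rightarrow> 'a ^ 3 ^ 3" where
  "conic_matrix a b c = vector [vector [0, a, b], vector [a, 0, c], vector [b, c, 0]]"

lemma mem_conic_of_iff:
  "X \<in> conic_of A \<longleftrightarrow> X \<in> pg_points \<and>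
     X $ 1 * (A $ 1 $ 1 * X $ 1 + A $ 1 $ 2 * X $ 2 + A $ 1 $ 3 * X $ 3) +
     X $ 2 * (A $ 2 $ 1 * X $ 1 + A $ 2 $ 2 * X $ 2 + A $ 2 $ 3 * X $ 3) +
     X $ 3 * (A $ 3 $ 1 * X $ 1 + A $ 3 $ 2 * X $ 2 + A $ 3 $ 3 * X $ 3) = 0"
  by (simp add: conic_of_def matrix_vector_mult_def sum_3)

lemma det_conic_matrix: "det (conic_matrix a b c) = 2 * a * b * c"
  by (simp add: det_3 conic_matrix_def algebra_simps)

text \<open>The value of the quadratic form at a basis point is the corresponding diagonal entry, so
  that entry vanishes; the determinant is then \<open>2 * a * b * c\<close>.\<close>

lemma C1_eq:
  assumes "(2 :: 'a::field) \<noteq> 0"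
  shows "C1 = {conic_of (conic_matrix a b c) | a b c :: 'a. a \<noteq> 0 \<and> b \<noteq> 0 \<and> c \<noteq> 0}"
proof (intro equalityI subsetI)
  fix C :: "('a ^ 3) set" assume "C \<in> C1"
  then obtain A where C: "C = conic_of A" and A: "transpose A = A" "det A \<noteq> 0"
    and e: "e1 \<in> conic_of A" "e2 \<in> conic_of A" "e3 \<in> conic_of A"
    by (auto simp: C1_def conics_def)
  have "transpose A $ i $ j = A $ j $ i" for i j
    by (simp add: transpose_def)
  then have "A $ 2 $ 1 = A $ 1 $ 2" "A $ 3 $ 1 = A $ 1 $ 3" "A $ 3 $ 2 = A $ 2 $ 3"
    by (metis A(1))+
  moreover have "A $ 1 $ 1 = 0" "A $ 2 $ 2 = 0" "A $ 3 $ 3 = 0"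
    using e by (simp_all add: mem_conic_of_iff)
  ultimately have "A = conic_matrix (A $ 1 $ 2) (A $ 1 $ 3) (A $ 2 $ 3)"
    by (simp add: vec3_eq_iff conic_matrix_def)
  then obtain a b c where abc: "A = conic_matrix a b c" by blast
  with A(2) have "a \<noteq> 0" "b \<noteq> 0" "c \<noteq> 0"
    by (auto simp: det_conic_matrix)
  with C abc show "C \<in> {conic_of (conic_matrix a b c) | a b c. a \<noteq> 0 \<and> b \<noteq> 0 \<and> c \<noteq> 0}"
    by blast
next
  fix C :: "('a ^ 3) set"
  assume "C \<in> {conic_of (conic_matrix a b c) | a b c. a \<noteq> 0 \<and> b \<noteq> 0 \<and> c \<noteq> 0}"
  then obtain a b c where C: "C = conic_of (conic_matrix a b c)"
    and nz: "a \<noteq> 0" "b \<noteq> 0" "c \<noteq> 0" by blast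
  have "transpose (conic_matrix a b c) = conic_matrix a b c"
    by (simp add: vec3_eq_iff conic_matrix_def transpose_def)
  moreover have "det (conic_matrix a b c) \<noteq> 0"
    using assms nz by (simp add: det_conic_matrix)
  moreover have "{e1, e2, e3} \<subseteq> C"
    by (simp add: C mem_conic_of_iff) (simp add: conic_matrix_def)
  ultimately show "C \<in> C1"
    by (auto simp: C1_def conics_def C)
qed

lemma affine_pt_mem_conic_iff:
  assumes "(2 :: 'a::field) \<noteq> 0"
  shows "affine_pt (x, y) \<in> conic_of (conic_matrix a b c) \<longleftrightarrow> a * x + b * y + c * x * (y :: 'a) = 0"
proof -
  have "affine_pt (x, y) \<in> conic_of (conic_matrix a b c) \<longleftrightarrow> 2 * (a * x + b * y + c * x * y) = 0"
    by (simp add: mem_conic_of_iff) (simp add: conic_matrix_def algebra_simps)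
  with assms show ?thesis by (simp only: mult_eq_0_iff simp_thms)
qed

text \<open>The third condition says that the quotients \<open>snd / fst\<close> differ, cleared of
  denominators.\<close>

definition unit_adj :: "'a::field \<times> 'a \<Rightarrow> 'a \<times> 'a \<Rightarrow> bool" where
  "unit_adj p r \<longleftrightarrow> fst p \<noteq> fst r \<and> snd p \<noteq> snd r \<and> fst p * snd r \<noteq> fst r * snd p"

text \<open>The coefficients \<open>(a, b, c)\<close> solve two linear equations. The entries of the
  cross product, which is a solution, are all nonzero exactly when the three conditions of
  \<open>unit_adj\<close> hold.\<close>

lemma ex_conic_through_iff:
  fixes x y x' y' :: "'a::field"
  assumes "x \<noteq> 0" "y \<noteq> 0" "x' \<noteq> 0" "y' \<noteq> 0" "(x, y) \<noteq> (x', y')"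
  shows "(\<exists>a b c. a \<noteq> 0 \<and> b \<noteq> 0 \<and> c \<noteq> 0 \<and> a * x + b * y + c * x * y = 0 \<and> a * x' + b * y' + c * x' * y' = 0)
    \<longleftrightarrow> unit_adj (x, y) (x', y')" (is "?L \<longleftrightarrow> ?R")
proof
  assume ?L
  then obtain a b c where nz: "a \<noteq> 0" "b \<noteq> 0" "c \<noteq> 0"
    and h: "a * x + b * y + c * x * y = 0" "a * x' + b * y' + c * x' * y' = 0" by blast
  \<comment> \<open>The first two identities treat points that share a coordinate; the third
    eliminates \<open>b\<close> from the two equations and treats points with equal
    quotients.\<close>
  have "(y - y') * (b + c * x) = (a * x + b * y + c * x * y) - (a * x + b * y' + c * x * y')"
    "(x - x') * (a + c * y) = (a * x + b * y + c * x * y) - (a * x' + b * y + c * x' * y)"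
    "c * (y * y') * (x - x') =
      y' * (a * x + b * y + c * x * y) - y * (a * x' + b * y' + c * x' * y') - a * (x * y' - x' * y)"
    by (simp_all add: algebra_simps)
  then have "x = x' \<Longrightarrow> (y - y') * (b + c * x) = 0" "y = y' \<Longrightarrow> (x - x') * (a + c * y) = 0"
    "x * y' = x' * y \<Longrightarrow> c * (y * y') * (x - x') = 0"
    using h by simp_all
  \<comment> \<open>If one of these factors vanished, the equation of the curve would reduce to
    \<open>a * x = 0\<close> or \<open>b * y = 0\<close>.\<close>
  moreover have "b + c * x \<noteq> 0" "a + c * y \<noteq> 0"
  proof -
    have "a * x + b * y + c * x * y = a * x + y * (b + c * x)"
      "a * x + b * y + c * x * y = b * y + x * (a + c * y)"
      by (simp_all add: algebra_simps)
    then have "b + c * x = 0 \<Longrightarrow> a * x = 0" "a + c * y = 0 \<Longrightarrow> b * y = 0"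
      unfolding h(1) by simp_all
    then show "b + c * x \<noteq> 0" "a + c * y \<noteq> 0" using nz assms by (metis mult_eq_0_iff)+
  qed
  ultimately show ?R
    using assms nz by (auto simp: unit_adj_def)
next
  assume ?R
  let ?a = "y * y' * (x' - x)" and ?b = "x * x' * (y - y')" and ?c = "x * y' - x' * y"
  \<comment> \<open>the cross product of \<open>(x, y, x y)\<close> and \<open>(x', y', x' y')\<close>\<close>
  have "?a \<noteq> 0" "?b \<noteq> 0" "?c \<noteq> 0"
    using \<open>?R\<close> assms by (auto simp: unit_adj_def)
  moreover have "?a * x + ?b * y + ?c * x * y = 0" "?a * x' + ?b * y' + ?c * x' * y' = 0"
    by (simp_all add: algebra_simps)
  ultimately show ?L
    by (intro exI[of _ ?a] exI[of _ ?b] exI[of _ ?c] conjI)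
qed

lemma point_graph_adj_affine_pt_iff:
  fixes p r :: "'a::field \<times> 'a"
  assumes "(2 :: 'a) \<noteq> 0" and p: "p \<in> units2" and r: "r \<in> units2"
  shows "point_graph_adj P1 C1 (\<in>) (affine_pt p) (affine_pt r) \<longleftrightarrow> unit_adj p r"
proof (cases "p = r")
  case True
  then show ?thesis by (simp add: point_graph_adj_def unit_adj_def)
next
  case False
  obtain x y x' y' where [simp]: "p = (x, y)" "r = (x', y')" by (metis surj_pair)
  have nz: "x \<noteq> 0" "y \<noteq> 0" "x' \<noteq> 0" "y' \<noteq> 0"
    using p r by (auto simp: units2_def)
  have "affine_pt p \<in> P1" "affine_pt r \<in> P1" "affine_pt p \<noteq> affine_pt r"
    using p r False injD[OF inj_affine_pt] unfolding P1_eq by blast+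
  then have "point_graph_adj P1 C1 (\<in>) (affine_pt p) (affine_pt r) \<longleftrightarrow>
      (\<exists>C\<in>C1. affine_pt (x, y) \<in> C \<and> affine_pt (x', y') \<in> C)"
    by (simp add: point_graph_adj_def)
  also have "\<dots> \<longleftrightarrow> (\<exists>a b c. a \<noteq> 0 \<and> b \<noteq> 0 \<and> c \<noteq> 0 \<and>
      a * x + b * y + c * x * y = 0 \<and> a * x' + b * y' + c * x' * y' = 0)"
    unfolding C1_eq[OF assms(1)]
    by (simp only: affine_pt_mem_conic_iff[OF assms(1), symmetric]) blast
  also have "\<dots> \<longleftrightarrow> unit_adj p r"
    using ex_conic_through_iff nz False by simp
  finally show ?thesis .
qed

subsection \<open>Counting\<close>

lemma card_Sigma_const:
  assumes "finite A" "\<And>a. a \<in> A \<Longrightarrow> card (B a) = k" "\<And>a. a \<in> A \<Longrightarrow> finite (B a)"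
  shows "card (Sigma A B) = card A * k"
  using assms by (simp add: card_SigmaI)

lemma card_units_diff:
  fixes S :: "'a::{field,finite} set"
  assumes "0 \<notin> S"
  shows "card (UNIV - {0} - S) = CARD('a) - 1 - card S"
  using assms by (subst card_Diff_subset) auto

text \<open>For a fixed first coordinate \<open>a\<close>, the quotient condition thus forbids a
  single second coordinate.\<close>

lemma eq_cross_iff:
  fixes x y a b :: "'a::field"
  assumes "x \<noteq> 0"
  shows "x * b = a * y \<longleftrightarrow> b = y / x * a"
  using assms by (auto simp: field_simps)

text \<open>The first coordinate avoids 0 and \<open>x\<close>; the second avoids 0,
  \<open>y\<close> and \<open>y / x * a\<close>, which are distinct because \<open>a\<close> is
  neither 0 nor \<open>x\<close>.\<close>

lemma card_unit_nbrs:
  fixes p :: "'a::{field,finite} \<times> 'a"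
  assumes "p \<in> units2"
  shows "card {z \<in> units2. unit_adj p z} = (CARD('a) - 2) * (CARD('a) - 3)"
proof -
  obtain x y where [simp]: "p = (x, y)" and nz: "x \<noteq> 0" "y \<noteq> 0"
    using assms by (auto simp: units2_def)
  have "{z \<in> units2. unit_adj p z} =
      (SIGMA a:UNIV - {0} - {x}. UNIV - {0} - {y, y / x * a})"
    using nz by (auto simp: units2_def unit_adj_def eq_cross_iff)
  moreover have "card (UNIV - {0} - {y, y / x * a}) = CARD('a) - 3" if "a \<in> UNIV - {0} - {x}" for a
    using that nz by (subst card_units_diff) (auto simp: card_insert_if field_simps)
  moreover have "card (UNIV - {0} - {x}) = CARD('a) - 2"
    using nz by (subst card_units_diff) auto
  ultimately show ?thesis
    by (simp add: card_Sigma_const)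
qed

text \<open>Here \<open>c\<close> and \<open>c'\<close> are the slopes of the lines joining the
  origin to the two points.\<close>

context
  fixes x y x' y' c c' :: "'a::{field,finite}"
  assumes nz: "x \<noteq> 0" "y \<noteq> 0" "x' \<noteq> 0" "y' \<noteq> 0"
  assumes c_def: "c = y / x" and c'_def: "c' = y' / x'"
begin

private lemma c_nz: "c \<noteq> 0" "c' \<noteq> 0"
  using nz by (simp_all add: c_def c'_def)

private lemma c_eq_iff: "c * a = y \<longleftrightarrow> a = x" "c' * a = y' \<longleftrightarrow> a = x'"
  using nz by (auto simp: c_def c'_def field_simps)

lemma unit_common_nbrs_eq:
  "{z \<in> units2. unit_adj (x, y) z \<and> unit_adj (x', y') z} =
     (SIGMA a:UNIV - {0} - {x, x'}. UNIV - {0} - {c * a, c' * a, y, y'})"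
  using nz by (auto simp: units2_def unit_adj_def eq_cross_iff c_def c'_def)

text \<open>
  The four forbidden second coordinates \<open>y, y', c a, c' a\<close> are distinct except for \<open>a = y' / c\<close> and
  \<open>a = y / c'\<close>, each of which saves one value (both if the two coincide).
\<close>

lemma card_unit_common_nbrs_generic:
  assumes "y \<noteq> y'" "c \<noteq> c'" "CARD('a) \<ge> 5"
  shows "card {z \<in> units2. unit_adj (x, y) z \<and> unit_adj (x', y') z} =
    (CARD('a) - 1 - card {x, x'}) * (CARD('a) - 5) + 2"
proof -
  let ?A = "UNIV - {0} - {x, x'}"
  let ?B = "\<lambda>a. {c * a, c' * a, y, y'}"
  \<comment> \<open>Four distinct forbidden values leave \<open>CARD('a) - 5\<close> nonzero ones.
    The bound \<open>CARD('a) \<ge> 5\<close> keeps this subtraction from truncating.\<close>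
  have 1: "card (UNIV - {0} - ?B a) =
      CARD('a) - 5 + ((if a = y' / c then 1 else 0) + (if a = y / c' then 1 else 0))"
    if "a \<in> ?A" for a
  proof -
    have "c * a \<noteq> y" "c' * a \<noteq> y'" "c * a \<noteq> c' * a"
      using that c_eq_iff assms by auto
    then have "card (?B a) + ((if c * a = y' then 1 else 0) + (if c' * a = y then 1 else 0)) = 4"
      using assms(1) by (simp add: card_insert_if)
    moreover have "c * a = y' \<longleftrightarrow> a = y' / c" "c' * a = y \<longleftrightarrow> a = y / c'"
      using c_nz by (auto simp: eq_divide_eq mult.commute)
    moreover have "card (UNIV - {0} - ?B a) = CARD('a) - 1 - card (?B a)"
      using that nz c_nz by (intro card_units_diff) auto
    ultimately show ?thesis using assms(3) by simp
  qed
  have "c * (y' / c) = y'" "c' * (y / c') = y"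
    using c_nz by simp_all
  \<comment> \<open>Both special values of \<open>a\<close> are admissible: one equal to
    \<open>x\<close> or \<open>x'\<close> would force \<open>y = y'\<close> or
    \<open>c = c'\<close>.\<close>
  then have "y' / c \<notin> {0, x, x'}" "y / c' \<notin> {0, x, x'}"
    using nz assms c_eq_iff c_nz by (metis insertE empty_iff mult_zero_right mult_cancel_right)+
  then have 2: "y' / c \<in> ?A" "y / c' \<in> ?A" by simp_all
  have "card (SIGMA a:?A. UNIV - {0} - ?B a) = (\<Sum>a\<in>?A. card (UNIV - {0} - ?B a))"
    by (simp add: card_SigmaI)
  also have "\<dots> = (\<Sum>a\<in>?A. CARD('a) - 5 +
      ((if a = y' / c then 1 else 0) + (if a = y / c' then 1 else 0)))"
    by (rule sum.cong[OF refl 1])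
  \<comment> \<open>The two indicators are summed separately, so they contribute 2 even if the
    special values coincide.\<close>
  also have "\<dots> = card ?A * (CARD('a) - 5) + 2"
    unfolding sum.distrib using 2 by (subst (1 2) sum.delta) (simp_all only: finite if_True sum_constant, simp)
  also have "card ?A = CARD('a) - 1 - card {x, x'}"
    using nz by (intro card_units_diff) auto
  finally show ?thesis by (simp add: unit_common_nbrs_eq)
qed

text \<open>Exactly one of \<open>y = y'\<close> and \<open>c = c'\<close> holds, as both would make
  the points equal. It merges two of the four forbidden values for every \<open>a\<close>, and no
  other coincidence occurs, so \<open>CARD('a) - 4\<close> nonzero values remain.\<close>

lemma card_unit_common_nbrs_degenerate:
  assumes "y = y' \<or> c = c'" "(x, y) \<noteq> (x', y')"
  shows "card {z \<in> units2. unit_adj (x, y) z \<and> unit_adj (x', y') z} =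
    (CARD('a) - 3) * (CARD('a) - 4)"
proof -
  have x: "x \<noteq> x'" using assms nz by (auto simp: c_def c'_def)
  have "card (UNIV - {0} - {c * a, c' * a, y, y'}) = CARD('a) - 4" if "a \<in> UNIV - {0} - {x, x'}" for a
  proof -
    have "c * a \<noteq> y" "c' * a \<noteq> y'"
      using that c_eq_iff by auto
    moreover have "c = c' \<Longrightarrow> y \<noteq> y'" "y = y' \<Longrightarrow> c \<noteq> c'"
      using x nz by (auto simp: c_def c'_def)
    ultimately have "card {c * a, c' * a, y, y'} = 3"
      using assms(1) that by (auto simp: card_insert_if)
    moreover have "card (UNIV - {0} - {c * a, c' * a, y, y'}) = CARD('a) - 1 - card {c * a, c' * a, y, y'}"
      using that nz c_nz by (intro card_units_diff) auto
    ultimately show ?thesis by simp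
  qed
  moreover have "card (UNIV - {0} - {x, x'}) = CARD('a) - 3"
    using nz x by (subst card_units_diff) auto
  ultimately show ?thesis
    by (simp add: unit_common_nbrs_eq card_Sigma_const)
qed

end

lemma card_unit_common_nbrs:
  fixes p r :: "'a::{field,finite} \<times> 'a"
  assumes "p \<in> units2" "r \<in> units2" "p \<noteq> r" "CARD('a) \<ge> 5"
  shows "card {z \<in> units2. unit_adj p z \<and> unit_adj r z} =
    (if unit_adj p r then (CARD('a) - 4)^2 + 1 else (CARD('a) - 3) * (CARD('a) - 4))"
proof -
  obtain x y x' y' where [simp]: "p = (x, y)" "r = (x', y')" by (metis surj_pair)
  have nz: "x \<noteq> 0" "y \<noteq> 0" "x' \<noteq> 0" "y' \<noteq> 0"
    using assms by (auto simp: units2_def)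
  \<comment> \<open>Writing the field size as \<open>n + 5\<close> turns the truncated differences
    into polynomials in \<open>n\<close>.\<close>
  define n where "n = CARD('a) - 5"
  have n: "CARD('a) = n + 5" using assms(4) by (simp add: n_def)
  have adj: "unit_adj p r \<longleftrightarrow> x \<noteq> x' \<and> y \<noteq> y' \<and> y / x \<noteq> y' / x'"
    using nz by (auto simp: unit_adj_def field_simps)
  show ?thesis
  proof (cases "y = y' \<or> y / x = y' / x'")
    case True
    then have "\<not> unit_adj p r" using adj by blast
    with card_unit_common_nbrs_degenerate[OF nz refl refl True] assms(3) show ?thesis by simp
  next
    case False
    \<comment> \<open>The generic count covers the adjacent pairs, with
      \<open>card {x, x'} = 2\<close>, and also the non-adjacent pairs with \<open>x = x'\<close>,
      where this cardinality is 1.\<close>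
    then show ?thesis
      using card_unit_common_nbrs_generic[OF nz refl refl] assms(4) adj
      by (cases "x = x'") (auto simp: n power2_eq_square algebra_simps)
  qed
qed

section \<open>Transfer of the counts to the point graph\<close>

theorem theorem3p6:
  fixes q :: nat
  assumes "CARD('a::{field,finite}) = q" and "primepow q" and "odd q" and "q \<ge> 5"
  shows "strongly_regular (P1 :: ('a ^ 3) set) (point_graph_adj P1 C1 (\<in>))
           ((q - 1)^2) ((q - 2) * (q - 3)) ((q - 4)^2 + 1) ((q - 3) * (q - 4))"
proof -
  let ?adj = "point_graph_adj (P1 :: ('a ^ 3) set) C1 (\<in>)"
  have two: "(2 :: 'a) \<noteq> 0"
    using assms two_neq_0_if_odd_CARD by blast
  note adj = point_graph_adj_affine_pt_iff[OF two]
  \<comment> \<open>A general predicate \<open>Q\<close> lets one transfer along the injection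
    \<open>affine_pt\<close> serve the vertex count, the degrees and the common neighbours.\<close>
  have card_P1: "card {z \<in> P1. Q z} = card {z \<in> units2. Q (affine_pt z)}" for Q :: "'a ^ 3 \<Rightarrow> bool"
  proof -
    have "{z \<in> P1. Q z} = affine_pt ` {z \<in> units2. Q (affine_pt z)}"
      by (auto simp: P1_eq)
    then show ?thesis
      by (simp add: card_image inj_on_subset[OF inj_affine_pt])
  qed
  have "simple_graph P1 ?adj"
    by (auto simp: simple_graph_def point_graph_adj_def)
  moreover have "card (P1 :: ('a ^ 3) set) = (q - 1)^2"
    using card_P1[of "\<lambda>_. True"] assms(1)
    by (simp add: units2_def card_cartesian_product power2_eq_square)
  moreover have "regular_graph P1 ?adj ((q - 2) * (q - 3))"
    unfolding regular_graph_def card_P1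
  proof
    fix X :: "'a ^ 3" assume "X \<in> P1"
    then obtain p where p: "p \<in> units2" "X = affine_pt p" by (auto simp: P1_eq)
    with card_unit_nbrs[OF p(1)] assms(1)
    show "card {z \<in> units2. ?adj X (affine_pt z)} = (q - 2) * (q - 3)"
      by (simp add: adj cong: conj_cong)
  qed
  moreover have "card (common_neighbours P1 ?adj X Y) =
      (if ?adj X Y then (q - 4)^2 + 1 else (q - 3) * (q - 4))"
    if XY: "X \<in> P1" "Y \<in> P1" "X \<noteq> Y" for X Y
  proof -
    obtain p r where "p \<in> units2" "r \<in> units2" "X = affine_pt p" "Y = affine_pt r"
      using XY unfolding P1_eq by blast
    moreover from this XY(3) have "p \<noteq> r" by blast
    ultimately show ?thesis
      using card_unit_common_nbrs[of p r] assms(1,4) unfolding common_neighbours_def card_P1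
      by (simp add: adj cong: conj_cong)
  qed
  moreover have "?adj X Y \<Longrightarrow> X \<noteq> Y" for X Y
    by (simp add: point_graph_adj_def)
  ultimately show ?thesis
    by (auto simp: strongly_regular_def)
qed

end
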